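(* Let $(X,\mathsf d)$ be a metric space and let $\mu=\mu_1+\cdots+\mu_k$, where for each $1\le j\le k$ the measure $\mu_j$ is supported on a closed set $Y_j\subset X$ and is Ahlfors $Q_j$-regular on $(Y_j,\mathsf d|_{Y_j})$, with $Q_j$ nondecreasing in $j$. Let $u\in L^1_{\mathrm{loc}}(X,\mu)$ and let $x\in\bigcap_{i=1}^{l}Y_{j_i}$, where $\{j_i\}$ is an increasing subsequence of $\{1,\dots,k\}$. Suppose that $Q_{j_1}=Q_{j_2}=\dots=Q_{j_n}<Q_{j_{n+1}}$ and that $$r^{Q_{j_i}-Q_{j_1}}\big|\Delta_{\mu_{j_i},r}^{\mathsf d}u(x)\big|\to0\quad\text{as } r\to0^+\qquad\text{for any } n+1\le i\le l.$$ Assume that $\Delta_{\mu_{j_1}}^{\mathsf d}u(x),\Delta_{\mu_{j_2}}^{\mathsf d}u(x),\dots,\Delta_{\mu_{j_n}}^{\mathsf d}u(x)$ exist. Assume also that $$\alpha_i(x):=\lim_{r\to0^+}\frac{\mu_{j_i}(B_r(x)\cap Y_{j_i})}{\mu(B_r(x))}$$ exists for any $1\le i\le n$. Then $\Delta_\mu^{\mathsf d}u(x)$ exists, $$\Delta_\mu^{\mathsf d}u(x)=\sum_{i=1}^n\alpha_i(x)\,\Delta_{\mu_{j_i}}^{\mathsf d}u(x),$$ and $\sum_{i=1}^n\alpha_i(x)=1$.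
   Context: $B_r(x)$ denotes the ball of center $x$ and radius $r$ in $(X,\mathsf d)$. For a Borel measure $\nu$ on $X$, the (pointwise) asymptotic mean value (AMV) quantities are $$\Delta_{\nu,r}^{\mathsf d}u(x):=\frac1{r^2}\,\frac{1}{\nu(B_r(x))}\int_{B_r(x)}\big(u(y)-u(x)\big)\,d\nu(y)\quad(r>0),\qquad \Delta_\nu^{\mathsf d}u(x):=\lim_{r\to0^+}\Delta_{\nu,r}^{\mathsf d}u(x),$$ the latter (the AMV Laplacian) being said to exist at $x$ when the limit exists. Convention: a function $u\in L^1_{\mathrm{loc}}(X,\mu)$ is evaluated pointwise through its representative whose value at $x$ is $\lim_{r\to0^+}\mu(B_r(x))^{-1}\int_{B_r(x)}u\,d\mu$ whenever this limit exists. For $Q\ge0$, a Borel measure $\nu$ on a metric space $(Y,\mathsf d)$ is Ahlfors $Q$-regular if there are constants $c,C>0$ such that $cr^Q\le\nu(B)\le Cr^Q$ for every metric ball $B\subset Y$ of radius $r>0$ ($c,C$ independent of $r$ and of the ball).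
   Formalization: The indices j_1,…,j_l are assumed to be all indices m with x in Y_m; otherwise the claim fails (e.g. Y_1=Y_2 a line in the plane Y_3, u=0, list {1,3}: α_1=1/2). The case n=l, with no Q_{j_{n+1}}, is included. *)

theory Defs
  imports "HOL-Analysis.Analysis"
begin

text \<open>The metric space is the type \<open>'a\<close>; Borel measures on it are measures whose sigma-algebra
  is that of \<^const>\<open>borel\<close>. Balls are the open balls \<^const>\<open>ball\<close>.\<close>

definition supported_on :: "'a::metric_space measure \<Rightarrow> 'a set \<Rightarrow> bool" where
  "supported_on \<nu> Y \<longleftrightarrow> emeasure \<nu> (- Y) = 0"

text \<open>The metric balls of the subspace \<open>Y\<close> are the sets \<open>ball y r \<inter> Y\<close> with \<open>y \<in> Y\<close>. All
  radii \<open>r > 0\<close> are allowed, not only those up to the diameter of \<open>Y\<close>.\<close>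

definition ahlfors_regular :: "real \<Rightarrow> 'a::metric_space set \<Rightarrow> 'a measure \<Rightarrow> bool" where
  "ahlfors_regular Q Y \<nu> \<longleftrightarrow> 0 \<le> Q \<and>
     (\<exists>c>0. \<exists>C>0. \<forall>y\<in>Y. \<forall>r>0.
        ennreal (c * r powr Q) \<le> emeasure \<nu> (ball y r \<inter> Y) \<and>
        emeasure \<nu> (ball y r \<inter> Y) \<le> ennreal (C * r powr Q))"

definition L1_loc :: "'a::metric_space measure \<Rightarrow> ('a \<Rightarrow> real) \<Rightarrow> bool" where
  "L1_loc \<mu> u \<longleftrightarrow> u \<in> borel_measurable \<mu> \<and> (\<forall>y. \<exists>r>0. set_integrable \<mu> (ball y r) u)"

definition ball_average :: "'a::metric_space measure \<Rightarrow> ('a \<Rightarrow> real) \<Rightarrow> 'a \<Rightarrow> real \<Rightarrow> real" where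
  "ball_average \<mu> u x r = (LINT y:ball x r|\<mu>. u y) / measure \<mu> (ball x r)"

text \<open>Pointwise value at \<open>x\<close> of a class in \<open>L\<^sup>1\<^bsub>loc\<^esub>(\<mu>)\<close> given by some function \<open>u\<close>. It is meant for
  points \<open>x\<close> all of whose balls have positive measure (otherwise the averages are \<open>0 / 0 = 0\<close>).\<close>

definition representative :: "'a::metric_space measure \<Rightarrow> ('a \<Rightarrow> real) \<Rightarrow> 'a \<Rightarrow> real" where
  "representative \<mu> u x =
     (if \<exists>L. (ball_average \<mu> u x \<longlongrightarrow> L) (at_right 0)
      then Lim (at_right 0) (ball_average \<mu> u x) else u x)"

text \<open>The AMV quantities of \<open>\<nu>\<close> for \<open>u \<in> L\<^sup>1\<^bsub>loc\<^esub>(\<mu>)\<close>, where \<open>\<nu>\<close> is absolutely continuous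
  with respect to \<open>\<mu>\<close>. The reference measure \<open>\<mu>\<close> enters only through the value of \<open>u\<close> at the
  centre \<open>x\<close>; the values \<open>u y\<close> in the integral matter only up to \<open>\<mu>\<close>-null sets, so there the
  given function \<open>u\<close> is used.\<close>

definition amv :: "'a::metric_space measure \<Rightarrow> 'a measure \<Rightarrow> ('a \<Rightarrow> real) \<Rightarrow> 'a \<Rightarrow> real \<Rightarrow> real" where
  "amv \<mu> \<nu> u x r =
     1 / r\<^sup>2 * (1 / measure \<nu> (ball x r)) * (LINT y:ball x r|\<nu>. (u y - representative \<mu> u x))"

definition amv_laplacian_exists ::
    "'a::metric_space measure \<Rightarrow> 'a measure \<Rightarrow> ('a \<Rightarrow> real) \<Rightarrow> 'a \<Rightarrow> bool" where
  "amv_laplacian_exists \<mu> \<nu> u x \<longleftrightarrow> (\<exists>L. (amv \<mu> \<nu> u x \<longlongrightarrow> L) (at_right 0))"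

definition amv_laplacian ::
    "'a::metric_space measure \<Rightarrow> 'a measure \<Rightarrow> ('a \<Rightarrow> real) \<Rightarrow> 'a \<Rightarrow> real" where
  "amv_laplacian \<mu> \<nu> u x = Lim (at_right 0) (amv \<mu> \<nu> u x)"

end

theory Submission
  imports Defs
begin

text \<open>A ball average against \<open>\<mu> = \<mu>\<^sub>1 + \<dots> + \<mu>\<^sub>k\<close> is the mean of the ball averages against the
  \<open>\<mu>\<^sub>m\<close>, weighted by the fractions \<open>\<mu>\<^sub>m(B\<^sub>r(x)) / \<mu>(B\<^sub>r(x))\<close>. All AMV quantities subtract the same
  number, the value at \<open>x\<close> of the representative for \<open>\<mu>\<close>, so they obey the same convex combination
  (\<open>amv_eq_weighted_sum\<close>), and it remains to let \<open>r\<close> tend to \<open>0\<close> in each summand.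

  A component whose closed support misses \<open>x\<close> has weight \<open>0\<close> for small \<open>r\<close>. Let \<open>Q\<^sub>0\<close> be the lowest
  dimension among the components through \<open>x\<close>. A component of dimension \<open>Q > Q\<^sub>0\<close> has weight
  \<open>O(r powr (Q - Q\<^sub>0))\<close>, because a single component of dimension \<open>Q\<^sub>0\<close> already gives \<open>B\<^sub>r(x)\<close> mass of
  order \<open>r powr Q\<^sub>0\<close> (\<open>ahlfors_regular_ball_ratio\<close>). So its weight tends to \<open>0\<close>, and the growth
  hypothesis on its AMV quantities is exactly what makes the whole summand tend to \<open>0\<close>. The
  components of dimension \<open>Q\<^sub>0\<close> contribute \<open>\<alpha>\<^sub>i\<close> times their Laplacians. For small \<open>r\<close> the weights add
  up to \<open>1\<close>, hence so do the surviving limits \<open>\<alpha>\<^sub>i\<close>.\<close>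

section \<open>Integrals and AMV quantities of a finite sum of measures\<close>

lemma nn_integral_sum_of_measures:
  fixes N :: "'b measure" and M :: "'i \<Rightarrow> 'b measure"
  assumes I: "finite I"
    and sets: "\<And>i. i \<in> I \<Longrightarrow> sets (M i) = sets N"
    and em: "\<And>A. A \<in> sets N \<Longrightarrow> emeasure N A = (\<Sum>i\<in>I. emeasure (M i) A)"
    and f: "f \<in> borel_measurable N"
  shows "(\<integral>\<^sup>+ y. f y \<partial>N) = (\<Sum>i\<in>I. \<integral>\<^sup>+ y. f y \<partial>M i)"
  using f
proof (induction rule: borel_measurable_induct)
  case (cong f g)
  have "(\<integral>\<^sup>+ y. f y \<partial>N) = (\<integral>\<^sup>+ y. g y \<partial>N)"
    using cong by (intro nn_integral_cong) auto
  moreover have "(\<integral>\<^sup>+ y. f y \<partial>M i) = (\<integral>\<^sup>+ y. g y \<partial>M i)" if "i \<in> I" for i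
    using cong sets_eq_imp_space_eq[OF sets[OF that]] by (intro nn_integral_cong) auto
  ultimately show ?case using cong by simp
next
  case (set A)
  then show ?case using em sets by simp
next
  case (mult u c)
  have "u \<in> borel_measurable (M i)" if "i \<in> I" for i
    using mult measurable_cong_sets[OF sets[OF that] refl] by blast
  then show ?case using mult
    by (simp add: nn_integral_cmult sum_distrib_left)
next
  case (add u v)
  have "u \<in> borel_measurable (M i)" "v \<in> borel_measurable (M i)" if "i \<in> I" for i
    using add measurable_cong_sets[OF sets[OF that] refl] by blast+
  then show ?case using add
    by (simp add: nn_integral_add sum.distrib)
next
  case (seq U)
  have U: "U m \<in> borel_measurable (M i)" if "i \<in> I" for i m
    using seq measurable_cong_sets[OF sets[OF that] refl] by blast
  have mono: "incseq (\<lambda>m. \<integral>\<^sup>+ y. U m y \<partial>L)" for L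
    using seq by (auto simp: incseq_def le_fun_def intro!: nn_integral_mono)
  have "(\<integral>\<^sup>+ y. (SUP m. U m) y \<partial>N) = (SUP m. \<integral>\<^sup>+ y. U m y \<partial>N)"
    unfolding SUP_apply by (rule nn_integral_monotone_convergence_SUP) (use seq in auto)
  also have "\<dots> = (SUP m. \<Sum>i\<in>I. \<integral>\<^sup>+ y. U m y \<partial>M i)"
    using seq by simp
  also have "\<dots> = (\<Sum>i\<in>I. SUP m. \<integral>\<^sup>+ y. U m y \<partial>M i)"
    by (rule ennreal_SUP_sum) (use mono in auto)
  also have "\<dots> = (\<Sum>i\<in>I. \<integral>\<^sup>+ y. (SUP m. U m) y \<partial>M i)"
    unfolding SUP_apply
    by (intro sum.cong refl nn_integral_monotone_convergence_SUP[symmetric]) (use seq U in auto)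
  finally show ?case .
qed

lemma
  fixes N :: "'b measure" and M :: "'i \<Rightarrow> 'b measure" and f :: "'b \<Rightarrow> real"
  assumes I: "finite I"
    and sets: "\<And>i. i \<in> I \<Longrightarrow> sets (M i) = sets N"
    and em: "\<And>A. A \<in> sets N \<Longrightarrow> emeasure N A = (\<Sum>i\<in>I. emeasure (M i) A)"
    and f: "integrable N f"
  shows integrable_sum_of_measures: "\<And>i. i \<in> I \<Longrightarrow> integrable (M i) f"
    and integral_sum_of_measures: "integral\<^sup>L N f = (\<Sum>i\<in>I. integral\<^sup>L (M i) f)"
proof -
  note nn = nn_integral_sum_of_measures[OF I sets em]
  have fm: "f \<in> borel_measurable N" using f by auto
  show int: "integrable (M i) f" if i: "i \<in> I" for i
  proof -
    have "(\<integral>\<^sup>+ y. ennreal (norm (f y)) \<partial>M i) \<le> (\<Sum>i\<in>I. \<integral>\<^sup>+ y. ennreal (norm (f y)) \<partial>M i)"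
      using I i by (intro member_le_sum) auto
    also have "\<dots> = (\<integral>\<^sup>+ y. ennreal (norm (f y)) \<partial>N)"
      by (subst nn) (use fm in auto)
    also have "\<dots> < \<infinity>" using f by (simp add: integrable_iff_bounded)
    finally have "(\<integral>\<^sup>+ y. ennreal (norm (f y)) \<partial>M i) < \<infinity>" .
    moreover have "f \<in> borel_measurable (M i)"
      using fm measurable_cong_sets[OF sets[OF i] refl] by blast
    ultimately show ?thesis by (simp add: integrable_iff_bounded)
  qed
  have part: "enn2real (\<integral>\<^sup>+ y. ennreal (g y) \<partial>N) = (\<Sum>i\<in>I. enn2real (\<integral>\<^sup>+ y. ennreal (g y) \<partial>M i))"
    if g: "g \<in> borel_measurable N" "\<And>i. i \<in> I \<Longrightarrow> integrable (M i) g" for g :: "'b \<Rightarrow> real"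
  proof -
    have "(\<integral>\<^sup>+ y. ennreal (g y) \<partial>M i) < \<infinity>" if "i \<in> I" for i
      using real_integrable_def[THEN iffD1, OF g(2)[OF that]] by (simp add: top.not_eq_extremum)
    then show ?thesis using g(1)
      by (subst nn) (auto simp: enn2real_sum comp_def)
  qed
  show "integral\<^sup>L N f = (\<Sum>i\<in>I. integral\<^sup>L (M i) f)"
    unfolding real_lebesgue_integral_def[OF f]
    using part[of f] part[of "\<lambda>y. - f y"] fm int
    by (simp add: real_lebesgue_integral_def sum_subtractf)
qed

text \<open>Every summand on the right is a fixed multiple of the integral over the ball against one \<open>M i\<close>,
  because the mass of the ball cancels. This survives a ball that is null for \<open>M i\<close>, where the
  division by \<open>0\<close> and the integral both give \<open>0\<close>.\<close>

lemma amv_eq_weighted_sum: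
  fixes N :: "'a::metric_space measure" and M :: "'i \<Rightarrow> 'a measure"
  assumes I: "finite I"
    and setsN: "sets N = sets borel"
    and sets: "\<And>i. i \<in> I \<Longrightarrow> sets (M i) = sets borel"
    and em: "\<And>A. A \<in> sets borel \<Longrightarrow> emeasure N A = (\<Sum>i\<in>I. emeasure (M i) A)"
    and fin: "emeasure N (ball x r) < \<infinity>"
    and u: "set_integrable N (ball x r) u"
  shows "amv \<rho> N u x r =
    (\<Sum>i\<in>I. measure (M i) (ball x r) / measure N (ball x r) * amv \<rho> (M i) u x r)"
proof -
  define f where "f = (\<lambda>y. u y - representative \<rho> u x)"
  have "set_integrable N (ball x r) (\<lambda>y. representative \<rho> u x)"
    using fin setsN unfolding set_integrable_def by (simp add: integrable_indicator_iff)
  then have f: "set_integrable N (ball x r) f"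
    unfolding f_def using u by (rule set_integral_diff(1)[rotated])
  have int: "(LINT y:ball x r|N. f y) = (\<Sum>i\<in>I. LINT y:ball x r|M i. f y)"
    unfolding set_lebesgue_integral_def
    by (rule integral_sum_of_measures)
      (use I sets setsN em f in \<open>simp_all add: set_integrable_def\<close>)
  have cancel: "measure (M i) (ball x r) * (1 / measure (M i) (ball x r) * (LINT y:ball x r|M i. f y))
      = (LINT y:ball x r|M i. f y)" if i: "i \<in> I" for i
  proof (cases "measure (M i) (ball x r) = 0")
    case True
    have "emeasure (M i) (ball x r) \<le> emeasure N (ball x r)"
      using I i em[of "ball x r"] by (auto intro!: member_le_sum)
    with fin True have "emeasure (M i) (ball x r) = 0"
      by (auto simp: measure_def enn2real_eq_0_iff)
    then have null: "ball x r \<in> null_sets (M i)"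
      using sets[OF i] by (intro null_setsI) auto
    have "(LINT y:ball x r|M i. f y) = 0"
      unfolding set_lebesgue_integral_def
      by (rule integral_eq_zero_AE) (use AE_not_in[OF null] in \<open>auto elim: eventually_mono\<close>)
    with True show ?thesis by simp
  qed simp
  have "amv \<rho> N u x r = 1 / r\<^sup>2 * (1 / measure N (ball x r)) * (\<Sum>i\<in>I. LINT y:ball x r|M i. f y)"
    unfolding amv_def int[symmetric] by (simp add: f_def)
  also have "\<dots> = (\<Sum>i\<in>I. 1 / r\<^sup>2 * (1 / measure N (ball x r)) *
      (measure (M i) (ball x r) * (1 / measure (M i) (ball x r) * (LINT y:ball x r|M i. f y))))"
    unfolding sum_distrib_left using cancel by (intro sum.cong) auto
  also have "\<dots> = (\<Sum>i\<in>I. measure (M i) (ball x r) / measure N (ball x r) * amv \<rho> (M i) u x r)"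
    by (intro sum.cong refl) (simp add: amv_def f_def)
  finally show ?thesis .
qed

section \<open>Small balls of Ahlfors regular measures\<close>

lemma emeasure_supported_on:
  fixes \<nu> :: "'a::metric_space measure"
  assumes "sets \<nu> = sets borel" "closed Y" "supported_on \<nu> Y" "A \<in> sets borel"
  shows "emeasure \<nu> A = emeasure \<nu> (A \<inter> Y)"
proof -
  have "- Y \<in> null_sets \<nu>"
    using assms by (intro null_setsI) (auto simp: supported_on_def)
  then have "emeasure \<nu> (A - (- Y)) = emeasure \<nu> A"
    using assms by (intro emeasure_Diff_null_set) auto
  then show ?thesis by (simp add: Diff_eq)
qed

lemma ahlfors_regular_ball_bounds:
  fixes \<nu> :: "'a::metric_space measure"
  assumes \<nu>: "sets \<nu> = sets borel" "closed Y" "supported_on \<nu> Y"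
    and reg: "ahlfors_regular Q Y \<nu>" and x: "x \<in> Y"
  obtains c C where "0 < c" "0 < C"
    "\<And>r. 0 < r \<Longrightarrow> emeasure \<nu> (ball x r) < \<infinity>"
    "\<And>r. 0 < r \<Longrightarrow> c * r powr Q \<le> measure \<nu> (ball x r)"
    "\<And>r. 0 < r \<Longrightarrow> measure \<nu> (ball x r) \<le> C * r powr Q"
proof -
  obtain c C where c: "0 < c" and C: "0 < C"
    and lo: "\<And>r. 0 < r \<Longrightarrow> ennreal (c * r powr Q) \<le> emeasure \<nu> (ball x r)"
    and up: "\<And>r. 0 < r \<Longrightarrow> emeasure \<nu> (ball x r) \<le> ennreal (C * r powr Q)"
    using reg x emeasure_supported_on[OF \<nu>] unfolding ahlfors_regular_def by fastforce
  have fin: "emeasure \<nu> (ball x r) < \<infinity>" if "0 < r" for r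
    using up[OF that] by (auto intro: le_less_trans)
  have eq: "emeasure \<nu> (ball x r) = ennreal (measure \<nu> (ball x r))" if "0 < r" for r
    using fin[OF that] by (intro emeasure_eq_ennreal_measure) auto
  show ?thesis
  proof (rule that[OF c C fin])
    show "c * r powr Q \<le> measure \<nu> (ball x r)" if "0 < r" for r
      using lo[OF that] unfolding eq[OF that] by simp
    show "measure \<nu> (ball x r) \<le> C * r powr Q" if "0 < r" for r
      using up[OF that] C unfolding eq[OF that] by simp
  qed
qed

text \<open>The upper regularity constant of \<open>\<nu>'\<close> over the lower one of \<open>\<nu>\<close> serves as \<open>K\<close>. For \<open>Q' > Q\<close>
  this makes \<open>\<nu>'\<close> negligible against \<open>\<nu>\<close> near a common point of the supports, at a rate given
  by the dimension gap.\<close>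

lemma ahlfors_regular_ball_ratio:
  fixes \<nu> \<nu>' :: "'a::metric_space measure"
  assumes \<nu>: "sets \<nu> = sets borel" "closed Y" "supported_on \<nu> Y" "ahlfors_regular Q Y \<nu>" "x \<in> Y"
    and \<nu>': "sets \<nu>' = sets borel" "closed Y'" "supported_on \<nu>' Y'" "ahlfors_regular Q' Y' \<nu>'"
      "x \<in> Y'"
  obtains K where
    "\<And>r. 0 < r \<Longrightarrow> measure \<nu>' (ball x r) / measure \<nu> (ball x r) \<le> K * r powr (Q' - Q)"
proof -
  obtain c where c: "0 < c" "\<And>r. 0 < r \<Longrightarrow> c * r powr Q \<le> measure \<nu> (ball x r)"
    using ahlfors_regular_ball_bounds[OF \<nu>] by metis
  obtain C where C: "0 < C" "\<And>r. 0 < r \<Longrightarrow> measure \<nu>' (ball x r) \<le> C * r powr Q'"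
    using ahlfors_regular_ball_bounds[OF \<nu>'] by metis
  have "measure \<nu>' (ball x r) / measure \<nu> (ball x r) \<le> (C / c) * r powr (Q' - Q)" if r: "0 < r" for r
  proof -
    have "measure \<nu>' (ball x r) / measure \<nu> (ball x r) \<le> (C * r powr Q') / (c * r powr Q)"
      using c C r by (intro frac_le) auto
    then show ?thesis by (simp add: powr_diff)
  qed
  then show ?thesis by (rule that)
qed

section \<open>The AMV Laplacian of a sum of Ahlfors regular measures\<close>

theorem corollary3p4:
  fixes \<mu> :: "'a::metric_space measure"
    and M :: "nat \<Rightarrow> 'a measure"
    and Y :: "nat \<Rightarrow> 'a set"
    and Q :: "nat \<Rightarrow> real"
    and j :: "nat \<Rightarrow> nat"
    and k l n :: nat
    and u :: "'a \<Rightarrow> real"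
    and x :: 'a
    and \<alpha> :: "nat \<Rightarrow> real"
  assumes "\<And>m. m \<in> {1..k} \<Longrightarrow> sets (M m) = sets borel"
    and "\<And>m. m \<in> {1..k} \<Longrightarrow> closed (Y m)"
    and "\<And>m. m \<in> {1..k} \<Longrightarrow> supported_on (M m) (Y m)"
    and "\<And>m. m \<in> {1..k} \<Longrightarrow> ahlfors_regular (Q m) (Y m) (M m)"
    and "mono_on {1..k} Q"
    and "sets \<mu> = sets borel"
    and "\<And>A. A \<in> sets borel \<Longrightarrow> emeasure \<mu> A = (\<Sum>m=1..k. emeasure (M m) A)"
    and "L1_loc \<mu> u"
    and "1 \<le> n" and "n \<le> l"
    and "strict_mono_on {1..l} j" and "j ` {1..l} \<subseteq> {1..k}"
    and "x \<in> (\<Inter>i\<in>{1..l}. Y (j i))"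
    and "\<And>m. m \<in> {1..k} - j ` {1..l} \<Longrightarrow> x \<notin> Y m"
    and "\<And>i. i \<in> {1..n} \<Longrightarrow> Q (j i) = Q (j 1)"
    and "n < l \<Longrightarrow> Q (j n) < Q (j (n + 1))"
    and "\<And>i. i \<in> {n+1..l} \<Longrightarrow>
           ((\<lambda>r. r powr (Q (j i) - Q (j 1)) * \<bar>amv \<mu> (M (j i)) u x r\<bar>) \<longlongrightarrow> 0) (at_right 0)"
    and "\<And>i. i \<in> {1..n} \<Longrightarrow> amv_laplacian_exists \<mu> (M (j i)) u x"
    and "\<And>i. i \<in> {1..n} \<Longrightarrow>
           ((\<lambda>r. measure (M (j i)) (ball x r \<inter> Y (j i)) / measure \<mu> (ball x r)) \<longlongrightarrow> \<alpha> i) (at_right 0)"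
  shows "amv_laplacian_exists \<mu> \<mu> u x
    \<and> amv_laplacian \<mu> \<mu> u x = (\<Sum>i=1..n. \<alpha> i * amv_laplacian \<mu> (M (j i)) u x)
    \<and> (\<Sum>i=1..n. \<alpha> i) = 1"
proof -
  note sets = assms(1) and closedY = assms(2) and supp = assms(3) and reg = assms(4)
    and mono = assms(5) and sets\<mu> = assms(6) and em = assms(7) and u = assms(8)
    and nl = assms(9,10) and j = assms(11,12) and xY = assms(13) and off = assms(14)
    and low = assms(15) and gap = assms(16) and growth = assms(17) and lap = assms(18)
    and weight = assms(19)
  have inj: "inj_on j {1..l}" using j(1) by (rule strict_mono_on_imp_inj_on)
  have eqD: "i' = i" if "j i' = j i" "i' \<in> {1..n}" "i \<in> {1..l}" for i i'
    using inj_onD[OF inj that(1)] that nl by auto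
  have jk: "j i \<in> {1..k}" if "i \<in> {1..l}" for i using j(2) that by blast
  have xj: "x \<in> Y (j i)" if "i \<in> {1..l}" for i using xY that by blast
  have l1: "1 \<in> {1..l}" using nl by auto
  define w where "w m r = measure (M m) (ball x r) / measure \<mu> (ball x r)" for m r

  have pos1: "0 < measure (M (j 1)) (ball x r)" if r: "0 < r" for r
  proof -
    note m = jk[OF l1]
    obtain c where "0 < c" "c * r powr Q (j 1) \<le> measure (M (j 1)) (ball x r)"
      using ahlfors_regular_ball_bounds[OF sets[OF m] closedY[OF m] supp[OF m] reg[OF m] xj[OF l1]] r
      by metis
    with r show ?thesis by (auto intro: less_le_trans[of 0 "c * r powr Q (j 1)"])
  qed

  \<comment> \<open>Supports that miss \<open>x\<close> are closed, so they miss all small balls around \<open>x\<close>.\<close>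
  have null: "\<forall>\<^sub>F r in at_right 0. emeasure (M m) (ball x r) = 0" if m: "m \<in> {1..k} - j ` {1..l}" for m
  proof -
    have "open (- Y m)" "x \<in> - Y m" using closedY off m by auto
    then obtain e where e: "0 < e" "ball x e \<subseteq> - Y m" by (meson open_contains_ball)
    have "emeasure (M m) (ball x r) = 0" if "r < e" for r
    proof -
      have "ball x r \<inter> Y m = {}" using e(2) that by (force simp: subset_iff)
      then show ?thesis using emeasure_supported_on[OF sets closedY supp, of m "ball x r"] m by auto
    qed
    then show ?thesis using e(1) unfolding eventually_at_right_field by blast
  qed
  have fin_m: "\<forall>\<^sub>F r in at_right 0. emeasure (M m) (ball x r) < \<infinity>" if m: "m \<in> {1..k}" for m
  proof (cases "m \<in> j ` {1..l}")
    case True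
    then have "x \<in> Y m" using xj by auto
    then have "emeasure (M m) (ball x r) < \<infinity>" if "0 < r" for r
      using ahlfors_regular_ball_bounds[OF sets[OF m] closedY[OF m] supp[OF m] reg[OF m]] that by metis
    then show ?thesis using eventually_at_right_less[of 0] by (auto elim: eventually_mono)
  next
    case False
    then show ?thesis using null[of m] m by (auto elim: eventually_mono)
  qed
  then have fin_all: "\<forall>\<^sub>F r in at_right 0. \<forall>m\<in>{1..k}. emeasure (M m) (ball x r) < \<infinity>"
    by (simp add: eventually_ball_finite_distrib)
  obtain R where R: "0 < R" "set_integrable \<mu> (ball x R) u"
    using u unfolding L1_loc_def by blast
  have small: "\<forall>\<^sub>F r in at_right 0. 0 < r \<and> set_integrable \<mu> (ball x r) u"
  proof -
    have "set_integrable \<mu> (ball x r) u" if "r < R" for r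
      using R(2) by (rule set_integrable_subset) (use that sets\<mu> in auto)
    then show ?thesis using R(1) unfolding eventually_at_right_field by blast
  qed
  have decomp: "\<forall>\<^sub>F r in at_right 0. 0 < r \<and> measure (M (j 1)) (ball x r) \<le> measure \<mu> (ball x r) \<and>
      (\<Sum>m=1..k. w m r) = 1 \<and> amv \<mu> \<mu> u x r = (\<Sum>m=1..k. w m r * amv \<mu> (M m) u x r)"
    using fin_all small
  proof eventually_elim
    case (elim r)
    have fin\<mu>: "emeasure \<mu> (ball x r) < \<infinity>"
      using elim em[of "ball x r"] by simp
    have "emeasure \<mu> (ball x r) = (\<Sum>m=1..k. ennreal (measure (M m) (ball x r)))"
      using elim em[of "ball x r"] by (simp add: emeasure_eq_ennreal_measure top.not_eq_extremum)
    then have sum: "measure \<mu> (ball x r) = (\<Sum>m=1..k. measure (M m) (ball x r))"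
      by (simp add: measure_def sum_nonneg)
    then have le: "measure (M (j 1)) (ball x r) \<le> measure \<mu> (ball x r)"
      using jk[OF l1] by (auto intro!: member_le_sum)
    then have "measure \<mu> (ball x r) \<noteq> 0" using pos1[of r] elim by auto
    then have "(\<Sum>m=1..k. w m r) = 1"
      unfolding w_def sum_divide_distrib[symmetric] sum[symmetric] by simp
    moreover have "amv \<mu> \<mu> u x r = (\<Sum>m=1..k. w m r * amv \<mu> (M m) u x r)"
      unfolding w_def by (rule amv_eq_weighted_sum) (use sets sets\<mu> em fin\<mu> elim in auto)
    ultimately show ?case using le elim by blast
  qed

  \<comment> \<open>The sums to pass to the limit in run over all components \<open>m\<close> of \<open>\<mu>\<close>, the claimed limits only over
    \<open>i \<le> n\<close>. \<open>lim g\<close> carries \<open>g\<close> over along \<open>j\<close>, with the value \<open>0\<close> off \<open>j ` {1..n}\<close>.\<close>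
  define lim where "lim g = (\<lambda>m. \<Sum>i\<in>{i\<in>{1..n}. j i = m}. g i)" for g :: "nat \<Rightarrow> real"
  have lim_low: "lim g (j i) = g i" if "i \<in> {1..n}" for g i
  proof -
    have "{i'\<in>{1..n}. j i' = j i} = {i}"
      using that eqD[of _ i] nl by auto
    then show ?thesis by (simp add: lim_def)
  qed
  have lim_other: "lim g m = 0" if "m \<notin> j ` {1..n}" for g m
    using that by (auto simp: lim_def intro!: sum.neutral)
  have sum_lim: "(\<Sum>m=1..k. lim g m) = (\<Sum>i=1..n. g i)" for g
    unfolding lim_def by (rule sum.group) (use jk nl in auto)

  have summand: "(w m \<longlongrightarrow> lim \<alpha> m) (at_right 0) \<and>
      ((\<lambda>r. w m r * amv \<mu> (M m) u x r) \<longlongrightarrow>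
        lim (\<lambda>i. \<alpha> i * amv_laplacian \<mu> (M (j i)) u x) m) (at_right 0)"
    if m: "m \<in> {1..k}" for m
  proof -
    consider (low) i where "i \<in> {1..n}" "m = j i" | (high) i where "i \<in> {n+1..l}" "m = j i"
      | (off) "m \<notin> j ` {1..l}"
    proof -
      have "{1..l} = {1..n} \<union> {n+1..l}" using nl by auto
      then show thesis using that by blast
    qed
    then show ?thesis
    proof cases
      case low
      have "emeasure (M m) (ball x r \<inter> Y m) = emeasure (M m) (ball x r)" for r
        using emeasure_supported_on[OF sets closedY supp] m by simp
      then have w: "(w m \<longlongrightarrow> \<alpha> i) (at_right 0)"
        using weight[OF low(1)] low(2) by (simp add: w_def[abs_def] measure_def)
      obtain L where L: "(amv \<mu> (M m) u x \<longlongrightarrow> L) (at_right 0)"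
        using lap[OF low(1)] low(2) unfolding amv_laplacian_exists_def by blast
      then have "amv_laplacian \<mu> (M m) u x = L"
        unfolding amv_laplacian_def by (intro tendsto_Lim) auto
      with L w show ?thesis using low lim_low by (auto intro!: tendsto_mult)
    next
      case high
      have il: "i \<in> {1..l}" using high by auto
      note j1 = jk[OF l1]
      have "m \<notin> j ` {1..n}"
        using high eqD[OF _ _ il] by fastforce
      note zero = lim_other[OF this]
      have "Q (j 1) < Q m"
      proof -
        have "n + 1 \<in> {1..l}" using high by auto
        moreover have "j (n + 1) \<le> j i"
          using strict_mono_on_leD[OF j(1)] calculation il high by auto
        ultimately have "Q (j (n + 1)) \<le> Q (j i)"
          using jk il by (intro mono_onD[OF mono]) auto
        then show ?thesis using gap high low[of n] nl by auto
      qed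
      then have pow: "((\<lambda>r. r powr (Q m - Q (j 1))) \<longlongrightarrow> 0) (at_right 0)"
        by (intro tendsto_zero_powrI) (auto simp: eventually_at_right_less eventually_mono[OF eventually_at_right_less])
      obtain K where K: "\<And>r. 0 < r \<Longrightarrow> measure (M m) (ball x r) / measure (M (j 1)) (ball x r)
          \<le> K * r powr (Q m - Q (j 1))"
        using ahlfors_regular_ball_ratio[OF
            sets[OF j1] closedY[OF j1] supp[OF j1] reg[OF j1] xj[OF l1]
            sets[OF m] closedY[OF m] supp[OF m] reg[OF m]] xj[OF il] high(2) by metis
      have bound: "\<forall>\<^sub>F r in at_right 0. 0 \<le> w m r \<and> w m r \<le> K * r powr (Q m - Q (j 1))"
        using decomp
      proof eventually_elim
        case (elim r)
        have "w m r \<le> measure (M m) (ball x r) / measure (M (j 1)) (ball x r)"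
          unfolding w_def using elim pos1[of r] by (intro divide_left_mono) auto
        also have "\<dots> \<le> K * r powr (Q m - Q (j 1))" using K elim by blast
        finally show ?case by (simp add: w_def)
      qed
      have "(w m \<longlongrightarrow> 0) (at_right 0)"
        by (rule tendsto_sandwich[OF _ _ tendsto_const tendsto_mult_right_zero[OF pow]])
          (use bound in \<open>auto elim: eventually_mono\<close>)
      moreover have "((\<lambda>r. w m r * amv \<mu> (M m) u x r) \<longlongrightarrow> 0) (at_right 0)"
      proof (rule tendsto_rabs_zero_cancel, rule tendsto_sandwich[OF _ _ tendsto_const])
        show "((\<lambda>r. K * (r powr (Q m - Q (j 1)) * \<bar>amv \<mu> (M m) u x r\<bar>)) \<longlongrightarrow> 0) (at_right 0)"
          using tendsto_mult_right_zero[OF growth[OF high(1)]] high(2) by simp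
        show "\<forall>\<^sub>F r in at_right 0. \<bar>w m r * amv \<mu> (M m) u x r\<bar>
            \<le> K * (r powr (Q m - Q (j 1)) * \<bar>amv \<mu> (M m) u x r\<bar>)"
          using bound
        proof eventually_elim
          case (elim r)
          then have "w m r * \<bar>amv \<mu> (M m) u x r\<bar> \<le> K * r powr (Q m - Q (j 1)) * \<bar>amv \<mu> (M m) u x r\<bar>"
            by (intro mult_right_mono) auto
          then show ?case using elim by (simp add: abs_mult mult.assoc)
        qed
      qed auto
      ultimately show ?thesis using zero by simp
    next
      case off
      then have "\<forall>\<^sub>F r in at_right 0. w m r = 0"
        using null[of m] m by (auto simp: w_def measure_def elim: eventually_mono)
      then have "(w m \<longlongrightarrow> 0) (at_right 0)"
        "((\<lambda>r. w m r * amv \<mu> (M m) u x r) \<longlongrightarrow> 0) (at_right 0)"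
        by (auto intro!: tendsto_eventually elim: eventually_mono)
      moreover have "m \<notin> j ` {1..n}" using off nl by auto
      ultimately show ?thesis using lim_other by simp
    qed
  qed

  have "((\<lambda>r. \<Sum>m=1..k. w m r) \<longlongrightarrow> (\<Sum>i=1..n. \<alpha> i)) (at_right 0)"
    unfolding sum_lim[symmetric] using summand by (intro tendsto_sum) auto
  moreover have "((\<lambda>r. \<Sum>m=1..k. w m r) \<longlongrightarrow> 1) (at_right 0)"
    using decomp by (intro tendsto_eventually) (auto elim: eventually_mono)
  ultimately have one: "(\<Sum>i=1..n. \<alpha> i) = 1"
    by (intro tendsto_unique[of "at_right (0::real)"]) auto
  have "((\<lambda>r. \<Sum>m=1..k. w m r * amv \<mu> (M m) u x r) \<longlongrightarrow>
      (\<Sum>i=1..n. \<alpha> i * amv_laplacian \<mu> (M (j i)) u x)) (at_right 0)"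
    unfolding sum_lim[symmetric] using summand by (intro tendsto_sum) auto
  then have "(amv \<mu> \<mu> u x \<longlongrightarrow> (\<Sum>i=1..n. \<alpha> i * amv_laplacian \<mu> (M (j i)) u x)) (at_right 0)"
    by (rule Lim_transform_eventually) (use decomp in \<open>auto elim: eventually_mono\<close>)
  then show ?thesis
    using one tendsto_Lim[OF trivial_limit_at_right_real]
    unfolding amv_laplacian_exists_def amv_laplacian_def by blast
qed

end
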